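(* Let $X$ be a Banach space. Then $\operatorname{wck}_{X}(B_{X})\leqslant R(X)$.
   Context: Banach spaces are infinite-dimensional, over the real or complex field; $B_X$ denotes the closed unit ball of $X$, and $X$ is regarded as a subspace of $X^{**}$ via the canonical embedding. For non-empty subsets $A,B$ of a Banach space, $\mathrm d(A,B)=\inf\{\|a-b\|: a\in A, b\in B\}$. For a bounded subset $A$ of $X$, $$\operatorname{wck}_X(A)=\sup\{\mathrm d(\mathrm{clust}_{X^{**}}((x_n)_{n=1}^\infty),X): (x_n)_{n=1}^\infty \text{ is a sequence in } A\},$$ where $\mathrm{clust}_{X^{**}}((x_n)_{n=1}^\infty)$ is the set of all weak$^*$ cluster points of $(x_n)$ in $X^{**}$. A sequence $(y_n)_{n=1}^\infty$ is a convex block subsequence of $(x_n)_{n=1}^\infty$ if there is a strictly increasing sequence of positive integers $(k_n)_{n=1}^\infty$ such that, with $k_0=0$, $y_n\in\operatorname{conv}\{x_i: k_{n-1}+1\leqslant i\leqslant k_n\}$ for every $n\in\mathbb N$. The collection of all convex block subsequences of $(x_n)$ is denoted $\operatorname{cbs}((x_n)_{n=1}^\infty)$. For a bounded sequence $(x_n)_{n=1}^\infty$ in a Banach space set $\operatorname{ca}((x_n)_{n=1}^\infty)=\inf_{n\in\mathbb N}\sup_{k,l\geqslant n}\|x_k-x_l\|$. Define $$R(X)=\sup_{(x_n)_{n=1}^\infty\subseteq B_X}\ \inf_{(z_n)\in\operatorname{cbs}((x_n))}\operatorname{ca}((z_n)_{n=1}^\infty),$$ where the supremum is over all sequences in $B_X$.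 *)

theory Defs
  imports "HOL-Analysis.Analysis"
begin

(* HOL-Analysis has no class of complex Banach spaces. A Banach space over 'k is therefore a type
   of class banach with a scalar multiplication s by 'k that extends the one by reals. It is used
   with 'k = real and s = scaleR, and with 'k = complex. *)

locale banach_space_over = vector_space s
  for s :: "'k::real_normed_field \<Rightarrow> 'a::banach \<Rightarrow> 'a" +
  assumes scale_of_real: "s (of_real r) x = r *\<^sub>R x"
    and norm_scale: "norm (s c x) = norm c * norm x"

lemma banach_space_over_scaleR:
  "banach_space_over (scaleR :: real \<Rightarrow> 'a::banach \<Rightarrow> 'a)"
  by unfold_locales (auto simp: algebra_simps)

definition infinite_dimensional :: "('k::field \<Rightarrow> 'a::ab_group_add \<Rightarrow> 'a) \<Rightarrow> bool" where
  "infinite_dimensional s \<longleftrightarrow> \<not> (\<exists>B. finite B \<and> module.span s B = UNIV)"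

definition dual :: "('k::real_normed_field \<Rightarrow> 'a::banach \<Rightarrow> 'a) \<Rightarrow> ('a \<Rightarrow>\<^sub>L 'k) set" where
  "dual s = {f. \<forall>c x. blinfun_apply f (s c x) = c * blinfun_apply f x}"

(* The dual is a set, not a type, so elements of the bidual are functions that are
   undefined outside the dual. The product a * f of a scalar and a functional is
   blinfun_mult_right a composed with f. *)

definition bidual ::
    "('k::real_normed_field \<Rightarrow> 'a::banach \<Rightarrow> 'a) \<Rightarrow> (('a \<Rightarrow>\<^sub>L 'k) \<Rightarrow> 'k) set" where
  "bidual s = {\<phi> \<in> extensional (dual s).
     (\<forall>f\<in>dual s. \<forall>g\<in>dual s. \<phi> (f + g) = \<phi> f + \<phi> g) \<and>
     (\<forall>a. \<forall>f\<in>dual s. \<phi> (blinfun_mult_right a o\<^sub>L f) = a * \<phi> f) \<and>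
     (\<exists>K. \<forall>f\<in>dual s. norm (\<phi> f) \<le> K * norm f)}"

definition bidual_norm ::
    "('k::real_normed_field \<Rightarrow> 'a::banach \<Rightarrow> 'a) \<Rightarrow> (('a \<Rightarrow>\<^sub>L 'k) \<Rightarrow> 'k) \<Rightarrow> real" where
  "bidual_norm s \<phi> = (SUP f\<in>{f \<in> dual s. norm f \<le> 1}. norm (\<phi> f))"

definition canonical_embedding ::
    "('k::real_normed_field \<Rightarrow> 'a::banach \<Rightarrow> 'a) \<Rightarrow> 'a \<Rightarrow> ('a \<Rightarrow>\<^sub>L 'k) \<Rightarrow> 'k" where
  "canonical_embedding s x = (\<lambda>f\<in>dual s. blinfun_apply f x)"

definition weak_star_topology ::
    "('k::real_normed_field \<Rightarrow> 'a::banach \<Rightarrow> 'a) \<Rightarrow> (('a \<Rightarrow>\<^sub>L 'k) \<Rightarrow> 'k) topology" where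
  "weak_star_topology s =
     subtopology (product_topology (\<lambda>_. euclidean) (dual s)) (bidual s)"

definition clust ::
    "('k::real_normed_field \<Rightarrow> 'a::banach \<Rightarrow> 'a) \<Rightarrow> (nat \<Rightarrow> 'a) \<Rightarrow> (('a \<Rightarrow>\<^sub>L 'k) \<Rightarrow> 'k) set" where
  "clust s x = {\<phi> \<in> bidual s. \<forall>U. openin (weak_star_topology s) U \<and> \<phi> \<in> U \<longrightarrow>
     (\<exists>\<^sub>F n in sequentially. canonical_embedding s (x n) \<in> U)}"

definition bidual_setdist :: "('k::real_normed_field \<Rightarrow> 'a::banach \<Rightarrow> 'a) \<Rightarrow>
    (('a \<Rightarrow>\<^sub>L 'k) \<Rightarrow> 'k) set \<Rightarrow> (('a \<Rightarrow>\<^sub>L 'k) \<Rightarrow> 'k) set \<Rightarrow> real" where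
  "bidual_setdist s A B =
     (INF (\<phi>, \<psi>)\<in>A \<times> B. bidual_norm s (\<lambda>f\<in>dual s. \<phi> f - \<psi> f))"

(* wck, ca and R_const use real-valued suprema and infima; they have the intended values for
   non-empty bounded A and for bounded sequences. *)

definition wck :: "('k::real_normed_field \<Rightarrow> 'a::banach \<Rightarrow> 'a) \<Rightarrow> 'a set \<Rightarrow> real" where
  "wck s A = (SUP x\<in>{x :: nat \<Rightarrow> 'a. range x \<subseteq> A}.
     bidual_setdist s (clust s x) (range (canonical_embedding s)))"

(* Sequences are indexed from 0, so the block {k (n-1) + 1, ..., k n} of indices
   becomes {k n..<k (Suc n)}. *)

definition cbs :: "(nat \<Rightarrow> 'a::real_vector) \<Rightarrow> (nat \<Rightarrow> 'a) set" where
  "cbs x = {y. \<exists>k :: nat \<Rightarrow> nat. k 0 = 0 \<and> strict_mono k \<and>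
     (\<forall>n. y n \<in> convex hull (x ` {k n..<k (Suc n)}))}"

definition ca :: "(nat \<Rightarrow> 'a::real_normed_vector) \<Rightarrow> real" where
  "ca x = (INF n. SUP (k, l)\<in>{n..} \<times> {n..}. norm (x k - x l))"

definition R_const :: "'a::banach itself \<Rightarrow> real" where
  "R_const _ = (SUP x\<in>{x :: nat \<Rightarrow> 'a. range x \<subseteq> cball 0 1}. INF z\<in>cbs x. ca z)"

end

theory Submission
  imports Defs
begin

text \<open>
  Let \<open>\<phi>\<close> be a weak* cluster point of a sequence in the unit ball (one exists by Tychonoff's
  theorem) at distance more than \<open>d\<close> from \<open>X\<close>. For finitely many points of \<open>X\<close> there is a
  functional in the dual unit ball whose real part vanishes at them and with \<open>Re \<phi>(f) > d\<close>:
  otherwise \<open>\<phi>\<close> is bounded by \<open>d\<close> on a subspace of finite codimension, and finitely many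
  one-dimensional Hahn-Banach steps put \<open>\<phi>\<close> within \<open>d\<close> of the span of these points. Choosing
  alternately such an \<open>f\<^sub>n\<close> and a term \<open>y\<^sub>n\<close> of the sequence yields \<open>Re f\<^sub>n(y\<^sub>k) = 0\<close> for \<open>k < n\<close>
  and \<open>Re f\<^sub>n(y\<^sub>k) > d\<close> for \<open>k \<ge> n\<close>. Hence convex combinations of disjoint successive blocks of
  \<open>(y\<^sub>n)\<close> are \<open>d\<close>-separated.
\<close>

section \<open>Hahn-Banach extension by finitely many dimensions\<close>

text \<open>A one-dimensional Hahn-Banach step for the seminorm \<open>d * norm g\<close>. The
  number \<open>c\<close> must lie above \<open>\<phi> g - d * norm g\<close> on the slice
  \<open>y g = 1\<close> and below \<open>d * norm h - \<phi> h\<close> on the slice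
  \<open>y h = -1\<close>. Such a \<open>c\<close> exists because \<open>g + h\<close> then lies in
  the kernel of \<open>y\<close>, where \<open>\<phi>\<close> is dominated.\<close>

lemma functional_one_step:
  fixes S :: "'v::real_normed_vector set" and \<phi> y :: "'v \<Rightarrow> real"
  assumes S: "subspace S"
    and add: "\<And>f g. f \<in> S \<Longrightarrow> g \<in> S \<Longrightarrow> \<phi> (f + g) = \<phi> f + \<phi> g"
    and scale: "\<And>r f. f \<in> S \<Longrightarrow> \<phi> (r *\<^sub>R f) = r * \<phi> f"
    and y: "linear y" and d: "0 \<le> d"
    and le: "\<And>g. g \<in> S \<Longrightarrow> y g = 0 \<Longrightarrow> \<phi> g \<le> d * norm g"
  shows "\<exists>c. \<forall>g\<in>S. \<phi> g - c * y g \<le> d * norm g"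
proof (cases "\<exists>e\<in>S. y e \<noteq> 0")
  case False
  then show ?thesis using le by (intro exI[of _ 0]) auto
next
  case True
  then obtain e where e: "e \<in> S" "y e \<noteq> 0" by blast
  define A where "A = {g \<in> S. y g = 1}"
  define c where "c = (SUP g\<in>A. \<phi> g - d * norm g)"
  have "(1 / y e) *\<^sub>R e \<in> A"
    using e S y by (simp add: A_def subspace_scale linear_cmul)
  then have ne: "A \<noteq> {}" by blast
  have key: "\<phi> g - d * norm g \<le> d * norm h - \<phi> h"
    if "g \<in> A" "h \<in> S" "y h = -1" for g h
  proof -
    have "\<phi> (g + h) \<le> d * norm (g + h)"
      using that S y by (intro le) (auto simp: A_def subspace_add linear_add)
    also have "\<dots> \<le> d * (norm g + norm h)"
      using d by (intro mult_left_mono norm_triangle_ineq)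
    finally show ?thesis using that add by (simp add: A_def algebra_simps)
  qed
  have "- ((1 / y e) *\<^sub>R e) \<in> S" "y (- ((1 / y e) *\<^sub>R e)) = -1"
    using e S y by (simp_all add: subspace_scale subspace_neg linear_cmul linear_neg)
  then have bdd: "bdd_above ((\<lambda>g. \<phi> g - d * norm g) ` A)"
    using key by (intro bdd_aboveI2) blast
  have lower: "\<phi> g - d * norm g \<le> c" if "g \<in> A" for g
    unfolding c_def by (rule cSUP_upper[OF that bdd])
  have upper: "c \<le> d * norm h - \<phi> h" if "h \<in> S" "y h = -1" for h
    unfolding c_def using key that by (intro cSUP_least ne) blast
  \<comment> \<open>Every \<open>g\<close> with \<open>y g \<noteq> 0\<close> is moved by a positive
    factor to the slice of value 1 or -1, according to the sign of \<open>y g\<close>.\<close>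
  have "\<phi> g - c * y g \<le> d * norm g" if g: "g \<in> S" for g
  proof -
    consider "y g = 0" | "y g > 0" | "y g < 0" by linarith
    then show ?thesis
    proof cases
      case 1
      then show ?thesis using le g by simp
    next
      case 2
      have "(1 / y g) *\<^sub>R g \<in> A" using g 2 S y by (simp add: A_def subspace_scale linear_cmul)
      from lower[OF this] show ?thesis using g 2 scale by (simp add: field_simps)
    next
      case 3
      have "(- 1 / y g) *\<^sub>R g \<in> S" "y ((- 1 / y g) *\<^sub>R g) = -1"
        using g 3 by (simp_all only: subspace_scale[OF S] linear_cmul[OF y]) simp
      from upper[OF this] show ?thesis using g 3 scale[OF g, of "-1 / y g"] by (simp add: field_simps)
    qed
  qed
  then show ?thesis by blast
qed

text \<open>Induction on \<open>I\<close>. The hypothesis for \<open>I\<close> is applied on the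
  kernel of \<open>y j\<close>, which is why \<open>S\<close> varies. The combination found there,
  subtracted from \<open>\<phi>\<close>, gives a functional dominated on this kernel, and one more
  step extends the bound to \<open>S\<close>.\<close>

lemma functional_finite_steps:
  fixes S :: "'v::real_normed_vector set" and \<phi> :: "'v \<Rightarrow> real" and y :: "'i \<Rightarrow> 'v \<Rightarrow> real"
  assumes "finite I" and "subspace S"
    and "\<And>f g. f \<in> S \<Longrightarrow> g \<in> S \<Longrightarrow> \<phi> (f + g) = \<phi> f + \<phi> g"
    and "\<And>r f. f \<in> S \<Longrightarrow> \<phi> (r *\<^sub>R f) = r * \<phi> f"
    and "\<And>i. i \<in> I \<Longrightarrow> linear (y i)" and "0 \<le> d"
    and "\<And>g. g \<in> S \<Longrightarrow> \<forall>i\<in>I. y i g = 0 \<Longrightarrow> \<phi> g \<le> d * norm g"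
  shows "\<exists>c. \<forall>g\<in>S. \<phi> g - (\<Sum>i\<in>I. c i * y i g) \<le> d * norm g"
  using assms
proof (induction I arbitrary: S rule: finite_induct)
  case empty
  then show ?case by simp
next
  case (insert j I)
  note add = insert.prems(2) and scale = insert.prems(3) and lin = insert.prems(4)
  have "subspace (S \<inter> {g. y j g = 0})"
    using insert.prems(1) lin[of j] by (simp add: subspace_inter linear_subspace_kernel)
  from insert.IH[OF this] obtain c where
    c: "\<forall>g\<in>S \<inter> {g. y j g = 0}. \<phi> g - (\<Sum>i\<in>I. c i * y i g) \<le> d * norm g"
    using insert.prems by auto
  have "\<exists>b. \<forall>g\<in>S. (\<phi> g - (\<Sum>i\<in>I. c i * y i g)) - b * y j g \<le> d * norm g"
  proof (rule functional_one_step[OF insert.prems(1)])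
    fix f g assume "f \<in> S" "g \<in> S"
    moreover have "(\<Sum>i\<in>I. c i * y i (f + g)) = (\<Sum>i\<in>I. c i * y i f) + (\<Sum>i\<in>I. c i * y i g)"
      unfolding sum.distrib[symmetric]
      by (intro sum.cong) (use lin in \<open>auto simp: linear_add algebra_simps\<close>)
    ultimately show "\<phi> (f + g) - (\<Sum>i\<in>I. c i * y i (f + g)) =
        \<phi> f - (\<Sum>i\<in>I. c i * y i f) + (\<phi> g - (\<Sum>i\<in>I. c i * y i g))"
      using add by simp
  next
    fix r f assume "f \<in> S"
    moreover have "(\<Sum>i\<in>I. c i * y i (r *\<^sub>R f)) = r * (\<Sum>i\<in>I. c i * y i f)"
      unfolding sum_distrib_left
      by (intro sum.cong) (use lin in \<open>auto simp: linear_cmul algebra_simps\<close>)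
    ultimately show "\<phi> (r *\<^sub>R f) - (\<Sum>i\<in>I. c i * y i (r *\<^sub>R f)) =
        r * (\<phi> f - (\<Sum>i\<in>I. c i * y i f))"
      using scale by (simp add: algebra_simps)
  qed (use c lin insert.prems in auto)
  then obtain b where b: "\<forall>g\<in>S. (\<phi> g - (\<Sum>i\<in>I. c i * y i g)) - b * y j g \<le> d * norm g"
    by blast
  have "(\<Sum>i\<in>I. (c(j := b)) i * y i g) = (\<Sum>i\<in>I. c i * y i g)" for g
    using insert.hyps by (intro sum.cong) auto
  then have "\<forall>g\<in>S. \<phi> g - (\<Sum>i\<in>insert j I. (c(j := b)) i * y i g) \<le> d * norm g"
    using b insert.hyps by (simp add: algebra_simps)
  then show ?case by (intro exI[of _ "c(j := b)"])
qed

section \<open>Cluster points in compact sets\<close>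

text \<open>Otherwise each point of \<open>K\<close> has an open neighbourhood that the sequence
  eventually avoids. Finitely many of these cover \<open>K\<close>, so some term avoids all of them
  although it lies in \<open>K\<close>.\<close>

lemma compactin_sequence_cluster_point:
  assumes K: "compactin T K" and x: "\<And>n. x n \<in> K"
  obtains \<phi> where "\<phi> \<in> K"
    "\<And>U. openin T U \<Longrightarrow> \<phi> \<in> U \<Longrightarrow> \<exists>\<^sub>F n in sequentially. x n \<in> U"
proof (rule ccontr)
  assume "\<not> thesis"
  then have "\<forall>\<phi>\<in>K. \<exists>U. openin T U \<and> \<phi> \<in> U \<and> (\<forall>\<^sub>F n in sequentially. x n \<notin> U)"
    unfolding not_frequently[symmetric] using that by blast
  then obtain U where U: "\<And>\<phi>. \<phi> \<in> K \<Longrightarrow> openin T (U \<phi>) \<and> \<phi> \<in> U \<phi> \<and>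
      (\<forall>\<^sub>F n in sequentially. x n \<notin> U \<phi>)" by metis
  have "\<forall>V\<in>U ` K. openin T V" "K \<subseteq> \<Union>(U ` K)" using U by auto
  with K obtain \<F> where F: "finite \<F>" "\<F> \<subseteq> U ` K" "K \<subseteq> \<Union>\<F>"
    unfolding compactin_def by meson
  have "\<forall>\<^sub>F n in sequentially. x n \<notin> V" if V: "V \<in> \<F>" for V
  proof -
    from V F(2) obtain \<phi> where "\<phi> \<in> K" "V = U \<phi>" by blast
    then show ?thesis using U by simp
  qed
  then have "\<forall>\<^sub>F n in sequentially. \<forall>V\<in>\<F>. x n \<notin> V"
    using F(1) by (simp add: eventually_ball_finite)
  from eventually_happens'[OF sequentially_bot this] obtain n where "\<forall>V\<in>\<F>. x n \<notin> V" ..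
  moreover have "x n \<in> \<Union>\<F>" using F(3) x[of n] by (rule subsetD)
  ultimately show False by blast
qed

section \<open>Bounds for \<open>ca\<close> and \<open>R_const\<close>\<close>

text \<open>Every tail contains the pair \<open>(Suc n, n)\<close>; boundedness of \<open>z\<close>
  ensures that the real-valued suprema are upper bounds.\<close>

lemma ca_ge:
  assumes z: "range z \<subseteq> cball 0 1" and d: "\<And>m n. m < n \<Longrightarrow> d \<le> norm (z n - z m)"
  shows "d \<le> ca z"
proof -
  have "d \<le> (SUP (k, l)\<in>{n..} \<times> {n..}. norm (z k - z l))" for n
  proof (rule cSUP_upper2[where x = "(Suc n, n)"])
    show "bdd_above ((\<lambda>(k, l). norm (z k - z l)) ` ({n..} \<times> {n..}))"
    proof (rule bdd_aboveI2, clarify)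
      fix k l
      have "norm (z k) \<le> 1" "norm (z l) \<le> 1" using z by (auto simp: image_subset_iff)
      then show "norm (z k - z l) \<le> 2" using norm_triangle_ineq4[of "z k" "z l"] by linarith
    qed
  qed (use d[of n "Suc n"] in auto)
  then show ?thesis unfolding ca_def by (intro cINF_greatest) auto
qed

text \<open>These bounds keep the real-valued infima and suprema in \<open>R_const\<close>
  meaningful.\<close>

lemma ca_bounds:
  assumes z: "range z \<subseteq> cball 0 1"
  shows "0 \<le> ca z" "ca z \<le> 2"
proof -
  have le: "norm (z k - z l) \<le> 2" for k l
  proof -
    have "norm (z k) \<le> 1" "norm (z l) \<le> 1" using z by (auto simp: image_subset_iff)
    then show ?thesis using norm_triangle_ineq4[of "z k" "z l"] by linarith
  qed
  show "0 \<le> ca z" using z by (intro ca_ge) auto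
  have "0 \<le> (SUP (k, l)\<in>{n..} \<times> {n..}. norm (z k - z l))" for n
    by (rule cSUP_upper2[where x = "(n, n)"]) (auto intro!: bdd_aboveI2[of _ _ 2] le)
  then have "ca z \<le> (SUP (k, l)\<in>{0..} \<times> {0..}. norm (z k - z l))"
    unfolding ca_def by (intro cINF_lower bdd_belowI2) auto
  also have "\<dots> \<le> 2" by (intro cSUP_least) (auto simp: le)
  finally show "ca z \<le> 2" .
qed

text \<open>With \<open>k = id\<close> all blocks are singletons. Hence infima over
  \<open>cbs x\<close> range over a non-empty set.\<close>

lemma cbs_self: "x \<in> cbs x"
  unfolding cbs_def by (rule CollectI, rule exI[of _ id]) (simp add: strict_mono_def hull_inc)

lemma range_cbs_subset:
  assumes "z \<in> cbs x" "range x \<subseteq> C" "convex C"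
  shows "range z \<subseteq> C"
proof -
  obtain k where "\<And>n. z n \<in> convex hull (x ` {k n..<k (Suc n)})"
    using assms(1) unfolding cbs_def by blast
  moreover have "convex hull (x ` {k n..<k (Suc n)}) \<subseteq> C" for n
    using assms by (intro hull_minimal) auto
  ultimately show ?thesis by blast
qed

lemma R_const_ge:
  fixes x :: "nat \<Rightarrow> 'a::banach"
  assumes x: "range x \<subseteq> cball 0 1" and d: "\<And>z. z \<in> cbs x \<Longrightarrow> d \<le> ca z"
  shows "d \<le> R_const TYPE('a)"
proof -
  have ball: "range z \<subseteq> cball 0 1" if "z \<in> cbs u" "range u \<subseteq> cball 0 1" for z u :: "nat \<Rightarrow> 'a"
    using range_cbs_subset[OF that] by simp
  \<comment> \<open>A uniform bound, so that the outer supremum in \<open>R_const\<close> is over a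
    set bounded above.\<close>
  have "(INF z\<in>cbs u. ca z) \<le> 2" if u: "range u \<subseteq> cball 0 1" for u :: "nat \<Rightarrow> 'a"
  proof -
    have "(INF z\<in>cbs u. ca z) \<le> ca u"
      by (intro cINF_lower cbs_self bdd_belowI2[of _ 0] ca_bounds(1) ball[OF _ u])
    also have "\<dots> \<le> 2" using u by (rule ca_bounds)
    finally show ?thesis .
  qed
  then have bdd: "bdd_above ((\<lambda>u :: nat \<Rightarrow> 'a. INF z\<in>cbs u. ca z) ` {u. range u \<subseteq> cball 0 1})"
    by (intro bdd_aboveI2[of _ _ 2]) auto
  have "d \<le> (INF z\<in>cbs x. ca z)"
    using d cbs_self by (intro cINF_greatest) auto
  also have "\<dots> \<le> R_const TYPE('a)"
    unfolding R_const_def using x bdd by (intro cSUP_upper) auto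
  finally show ?thesis .
qed

(* Treats both scalar fields at once: re is the identity for the reals, Re for the complex numbers. *)
locale banach_space_re = banach_space_over s
  for s :: "'k::{real_normed_field, heine_borel} \<Rightarrow> 'a::banach \<Rightarrow> 'a" +
  fixes re :: "'k \<Rightarrow> real"
  assumes linear_re: "linear re"
    and re_le_norm: "re z \<le> norm z"
    and re_rotation: "\<exists>u. norm u = 1 \<and> re (u * z) = norm z"
begin

section \<open>The dual and the bidual as real vector spaces\<close>

lemma dual_add: "f \<in> dual s \<Longrightarrow> g \<in> dual s \<Longrightarrow> f + g \<in> dual s"
  by (simp add: dual_def blinfun.bilinear_simps algebra_simps)

lemma dual_mult: "f \<in> dual s \<Longrightarrow> blinfun_mult_right a o\<^sub>L f \<in> dual s"
  by (simp add: dual_def)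

text \<open>Connects the real scaling of bounded linear maps with the multiplication by scalars in
  terms of which \<open>bidual\<close> is defined, so that the real Hahn-Banach steps apply over
  both fields.\<close>

lemma scaleR_eq_mult: "r *\<^sub>R f = blinfun_mult_right (of_real r) o\<^sub>L f"
  for f :: "'a \<Rightarrow>\<^sub>L 'k"
  by (rule blinfun_eqI) (simp add: blinfun.bilinear_simps scaleR_conv_of_real)

lemma norm_mult_le: "norm (blinfun_mult_right a o\<^sub>L f) \<le> norm a * norm f"
  for f :: "'a \<Rightarrow>\<^sub>L 'k"
  by (rule norm_blinfun_bound)
    (auto simp: norm_mult mult.assoc intro!: mult_left_mono norm_blinfun)

lemma subspace_dual: "real_vector.subspace (dual s)"
proof (rule real_vector.subspaceI)
  show "0 \<in> dual s" by (simp add: dual_def)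
qed (simp_all add: dual_add dual_mult scaleR_eq_mult)

lemma canonical_embedding_bidual: "canonical_embedding s x \<in> bidual s"
  unfolding bidual_def canonical_embedding_def
  using norm_blinfun[of _ x]
  by (auto simp: dual_add dual_mult blinfun.bilinear_simps mult.commute
      intro!: exI[of _ "norm x"])

lemma bidual_scaleR: "\<phi> \<in> bidual s \<Longrightarrow> f \<in> dual s \<Longrightarrow> \<phi> (r *\<^sub>R f) = r *\<^sub>R \<phi> f"
  by (simp add: bidual_def scaleR_eq_mult scaleR_conv_of_real)

section \<open>Weak* cluster points\<close>

text \<open>A cluster point exists in a compact product of balls. It is bounded by membership in the
  product, and linear because each linearity relation is a closed condition satisfied by all
  embedded points.\<close>

lemma clust_nonempty:
  assumes x: "range x \<subseteq> cball 0 1"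
  shows "clust s x \<noteq> {}"
proof -
  define T where "T = product_topology (\<lambda>_ :: 'a \<Rightarrow>\<^sub>L 'k. euclidean :: 'k topology) (dual s)"
  \<comment> \<open>The radius comes from \<open>norm (blinfun_apply f (x n)) \<le> norm f\<close>;
    closed balls of scalars are compact, so \<open>K\<close> is compact by Tychonoff.\<close>
  define K where "K = PiE (dual s) (\<lambda>f. cball (0 :: 'k) (norm f))"
  have "compactin T K"
    unfolding T_def K_def by (simp add: compactin_PiE)
  moreover have "canonical_embedding s (x n) \<in> K" for n
  proof -
    have "norm (x n) \<le> 1" using x by (auto simp: image_subset_iff)
    then have "norm (blinfun_apply f (x n)) \<le> norm f" for f :: "'a \<Rightarrow>\<^sub>L 'k"
      using norm_blinfun[of f "x n"] mult_left_mono[of "norm (x n)" 1 "norm f"] by simp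
    then show ?thesis unfolding K_def canonical_embedding_def by auto
  qed
  ultimately obtain \<phi> where \<phi>: "\<phi> \<in> K" and freq: "\<And>U. openin T U \<Longrightarrow> \<phi> \<in> U \<Longrightarrow>
      \<exists>\<^sub>F n in sequentially. canonical_embedding s (x n) \<in> U"
    by (rule compactin_sequence_cluster_point[of T K "\<lambda>n. canonical_embedding s (x n)"]) blast
  have top: "\<phi> \<in> topspace T" using \<phi> unfolding T_def K_def by auto
  have eval: "continuous_map T euclidean (\<lambda>\<psi>. \<psi> f)" if "f \<in> dual s" for f
    unfolding T_def using that by (rule continuous_map_product_projection)
  \<comment> \<open>If \<open>h \<phi>\<close> were non-zero, the open set where \<open>h\<close>
    does not vanish would contain some embedded \<open>x n\<close>.\<close>
  have zero: "h \<phi> = 0" if h: "continuous_map T euclidean h"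
    and 0: "\<And>y. h (canonical_embedding s y) = 0" for h :: "_ \<Rightarrow> 'k"
  proof (rule ccontr)
    assume "h \<phi> \<noteq> 0"
    moreover have "openin T {\<psi> \<in> topspace T. h \<psi> \<in> - {0}}"
      by (intro openin_continuous_map_preimage[OF h]) auto
    ultimately have "\<exists>n. canonical_embedding s (x n) \<in> {\<psi> \<in> topspace T. h \<psi> \<in> - {0}}"
      using top by (intro frequently_ex[OF freq]) auto
    then show False using 0 by auto
  qed
  have "\<phi> (f + g) - (\<phi> f + \<phi> g) = 0" if "f \<in> dual s" "g \<in> dual s" for f g
  proof (rule zero[of "\<lambda>\<psi>. \<psi> (f + g) - (\<psi> f + \<psi> g)"])
    show "continuous_map T euclidean (\<lambda>\<psi>. \<psi> (f + g) - (\<psi> f + \<psi> g))"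
      by (intro continuous_map_diff continuous_map_add eval dual_add that)
  qed (use that in \<open>auto simp: dual_add canonical_embedding_def blinfun.bilinear_simps\<close>)
  moreover have "\<phi> (blinfun_mult_right a o\<^sub>L f) - a * \<phi> f = 0" if f: "f \<in> dual s" for a f
  proof (rule zero[of "\<lambda>\<psi>. \<psi> (blinfun_mult_right a o\<^sub>L f) - a * \<psi> f"])
    have "continuous_map euclidean euclidean (\<lambda>z. a * z)"
      by (simp add: continuous_intros)
    from continuous_map_compose[OF eval[OF f] this]
    show "continuous_map T euclidean (\<lambda>\<psi>. \<psi> (blinfun_mult_right a o\<^sub>L f) - a * \<psi> f)"
      by (intro continuous_map_diff eval dual_mult f) (simp add: o_def)
  qed (use f in \<open>auto simp: dual_mult canonical_embedding_def\<close>)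
  moreover have "\<forall>f\<in>dual s. norm (\<phi> f) \<le> 1 * norm f" "\<phi> \<in> extensional (dual s)"
    using \<phi> unfolding K_def by (auto simp: PiE_iff)
  ultimately have bid: "\<phi> \<in> bidual s" unfolding bidual_def by (auto intro: exI[of _ 1])
  have "\<exists>\<^sub>F n in sequentially. canonical_embedding s (x n) \<in> U"
    if "openin (weak_star_topology s) U" "\<phi> \<in> U" for U
  proof -
    from that obtain V where V: "openin T V" "U = V \<inter> bidual s"
      unfolding weak_star_topology_def T_def openin_subtopology by blast
    with that freq[of V] show ?thesis by (simp add: canonical_embedding_bidual)
  qed
  with bid have "\<phi> \<in> clust s x" unfolding clust_def by blast
  then show ?thesis by blast
qed

text \<open>Finitely many strict inequalities between real parts define a weak* neighbourhood of
  \<open>\<phi>\<close>, which the sequence must visit.\<close>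

lemma clust_approx:
  assumes \<phi>: "\<phi> \<in> clust s x" and G: "finite G" "G \<subseteq> dual s"
    and d: "\<And>g. g \<in> G \<Longrightarrow> d < re (\<phi> g)"
  shows "\<exists>m. \<forall>g\<in>G. d < re (blinfun_apply g (x m))"
proof -
  define U where "U = {\<psi> \<in> topspace (weak_star_topology s). \<forall>g\<in>G. \<psi> g \<in> re -` {d<..}}"
  have "continuous_map (weak_star_topology s) euclidean (\<lambda>\<psi>. \<psi> g)" if "g \<in> G" for g
    unfolding weak_star_topology_def using that G
    by (intro continuous_map_from_subtopology continuous_map_product_projection) auto
  moreover have "open (re -` {d<..})"
  proof -
    \<comment> \<open>Applying \<open>re_le_norm\<close> to \<open>z\<close> and to
      \<open>-z\<close> makes \<open>re\<close> bounded, hence continuous.\<close>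
    have "norm (re z) \<le> norm z * 1" for z
      using re_le_norm[of z] re_le_norm[of "-z"] by (simp add: linear_neg[OF linear_re])
    with linear_re have "bounded_linear re"
      by (auto intro!: bounded_linear_intro[of _ 1] simp: linear_add linear_cmul)
    then show ?thesis
      by (intro open_vimage) (auto simp: linear_continuous_on)
  qed
  ultimately have "openin (weak_star_topology s)
      {\<psi> \<in> topspace (weak_star_topology s). \<psi> g \<in> re -` {d<..}}" if "g \<in> G" for g
    using that by (intro openin_continuous_map_preimage) auto
  then have "openin (weak_star_topology s) (topspace (weak_star_topology s) \<inter>
      (\<Inter>g\<in>G. {\<psi> \<in> topspace (weak_star_topology s). \<psi> g \<in> re -` {d<..}}))"
    using G(1) by (intro openin_Int_Inter) auto
  also have "\<dots> = U" unfolding U_def by auto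
  finally have "openin (weak_star_topology s) U" .
  moreover have "\<phi> \<in> bidual s" using \<phi> unfolding clust_def by blast
  then have "\<phi> \<in> topspace (weak_star_topology s)"
    unfolding weak_star_topology_def bidual_def by (simp add: PiE_iff)
  with d have "\<phi> \<in> U" unfolding U_def by simp
  ultimately have "\<exists>\<^sub>F n in sequentially. canonical_embedding s (x n) \<in> U"
    using \<phi> unfolding clust_def by blast
  from frequently_ex[OF this] obtain m where "canonical_embedding s (x m) \<in> U" ..
  then have "\<forall>g\<in>G. d < re (canonical_embedding s (x m) g)" unfolding U_def by simp
  then have "\<forall>g\<in>G. d < re (blinfun_apply g (x m))"
    using G(2) by (simp add: canonical_embedding_def subset_iff)
  then show ?thesis ..
qed

section \<open>Functionals vanishing at finitely many points\<close>

lemma functional_vanishing_on_finite: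
  assumes \<phi>: "\<phi> \<in> bidual s" and "0 \<le> d" and Y: "finite Y"
    and far: "\<And>x. d < bidual_norm s (\<lambda>f\<in>dual s. \<phi> f - canonical_embedding s x f)"
  shows "\<exists>f\<in>dual s. norm f \<le> 1 \<and> (\<forall>y\<in>Y. re (blinfun_apply f y) = 0) \<and> d < re (\<phi> f)"
proof (rule ccontr)
  assume neg: "\<not> ?thesis"
  have le: "re (\<phi> g) \<le> d * norm g"
    \<comment> \<open>The negated claim bounds functionals in the unit ball; dividing by
      \<open>norm g\<close> extends the bound to all functionals whose real part vanishes on
      \<open>Y\<close>.\<close>
    if g: "g \<in> dual s" "\<forall>y\<in>Y. re (blinfun_apply g y) = 0" for g
  proof (cases "g = 0")
    case True
    have "\<phi> (0 *\<^sub>R g) = 0 *\<^sub>R \<phi> g" using \<phi> g(1) by (rule bidual_scaleR)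
    with True show ?thesis by (simp add: linear_0[OF linear_re])
  next
    case False
    define h where "h = (1 / norm g) *\<^sub>R g"
    have "h \<in> dual s" unfolding h_def using g(1) subspace_dual by (rule real_vector.subspace_scale[rotated])
    moreover have "norm h \<le> 1" "\<forall>y\<in>Y. re (blinfun_apply h y) = 0"
      using g False by (auto simp: h_def blinfun.bilinear_simps linear_cmul[OF linear_re])
    ultimately have "re (\<phi> h) \<le> d" using neg by force
    moreover have "re (\<phi> h) = re (\<phi> g) / norm g"
      unfolding h_def bidual_scaleR[OF \<phi> g(1)] by (simp add: linear_cmul[OF linear_re])
    ultimately show ?thesis using False by (simp add: field_simps)
  qed
  have "\<exists>c. \<forall>g\<in>dual s. re (\<phi> g) - (\<Sum>y\<in>Y. c y * re (blinfun_apply g y)) \<le> d * norm g"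
  proof (rule functional_finite_steps[OF Y subspace_dual])
    show "linear (\<lambda>g. re (blinfun_apply g y))" for y
      by (rule linearI) (auto simp: blinfun.bilinear_simps linear_add linear_cmul linear_re)
  qed (use \<phi> le \<open>0 \<le> d\<close> in \<open>auto simp: bidual_scaleR linear_cmul linear_add linear_re bidual_def\<close>)
  then obtain c where c: "re (\<phi> g) - (\<Sum>y\<in>Y. c y * re (blinfun_apply g y)) \<le> d * norm g"
    if "g \<in> dual s" for g by blast
  \<comment> \<open>The real coefficients of the extension steps give the point of \<open>X\<close>
    that will be too close to \<open>\<phi>\<close>.\<close>
  define x where "x = (\<Sum>y\<in>Y. c y *\<^sub>R y)"
  have re_x: "re (blinfun_apply g x) = (\<Sum>y\<in>Y. c y * re (blinfun_apply g y))" for g :: "'a \<Rightarrow>\<^sub>L 'k"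
    unfolding x_def
    by (simp add: blinfun.bilinear_simps blinfun.sum_right linear_sum[OF linear_re]
        linear_cmul[OF linear_re])
  have "norm (\<phi> f - blinfun_apply f x) \<le> d" if f: "f \<in> dual s" "norm f \<le> 1" for f
  proof -
    \<comment> \<open>Replacing \<open>f\<close> by its rotation \<open>u * f\<close>, again in the
      dual unit ball, turns the bound for real parts into one for absolute values.\<close>
    obtain u where u: "norm u = 1" "re (u * (\<phi> f - blinfun_apply f x)) =
        norm (\<phi> f - blinfun_apply f x)" using re_rotation by blast
    let ?g = "blinfun_mult_right u o\<^sub>L f"
    have "\<phi> ?g = u * \<phi> f" using \<phi> f(1) unfolding bidual_def by blast
    then have "norm (\<phi> f - blinfun_apply f x) = re (\<phi> ?g - blinfun_apply ?g x)"
      using u(2) by (simp add: algebra_simps)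
    also have "\<dots> = re (\<phi> ?g) - (\<Sum>y\<in>Y. c y * re (blinfun_apply ?g y))"
      by (simp only: linear_diff[OF linear_re] re_x)
    also have "\<dots> \<le> d * norm ?g" by (intro c dual_mult f)
    also have "\<dots> \<le> d * 1"
      using norm_mult_le[of u f] f u \<open>0 \<le> d\<close> by (intro mult_left_mono) auto
    finally show ?thesis by simp
  qed
  then have "bidual_norm s (\<lambda>f\<in>dual s. \<phi> f - canonical_embedding s x f) \<le> d"
    unfolding bidual_norm_def canonical_embedding_def
    by (intro cSUP_least) (auto intro!: exI[of _ 0] real_vector.subspace_0[OF subspace_dual])
  with far[of x] show False by simp
qed

text \<open>Provides the lower bound that makes \<open>bidual_setdist\<close> a genuine
  infimum.\<close>

lemma bidual_norm_diff_nonneg: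
  assumes "\<phi> \<in> bidual s" "\<psi> \<in> bidual s"
  shows "0 \<le> bidual_norm s (\<lambda>f\<in>dual s. \<phi> f - \<psi> f)"
proof -
  obtain K L where K: "\<And>f. f \<in> dual s \<Longrightarrow> norm (\<phi> f) \<le> K * norm f"
    and L: "\<And>f. f \<in> dual s \<Longrightarrow> norm (\<psi> f) \<le> L * norm f"
    using assms unfolding bidual_def by blast
  have "norm (\<phi> f - \<psi> f) \<le> \<bar>K\<bar> + \<bar>L\<bar>" if f: "f \<in> dual s" "norm f \<le> 1" for f
  proof -
    have "a * norm f \<le> \<bar>a\<bar>" for a :: real
      using f mult_right_mono[of a "\<bar>a\<bar>" "norm f"] mult_left_mono[of "norm f" 1 "\<bar>a\<bar>"]
      by (simp add: abs_ge_self)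
    from this[of K] this[of L] have "K * norm f \<le> \<bar>K\<bar>" "L * norm f \<le> \<bar>L\<bar>" .
    then show ?thesis using norm_triangle_ineq4[of "\<phi> f" "\<psi> f"] K[OF f(1)] L[OF f(1)] by linarith
  qed
  then have "bdd_above ((\<lambda>f. norm ((\<lambda>f\<in>dual s. \<phi> f - \<psi> f) f)) ` {f \<in> dual s. norm f \<le> 1})"
    by (intro bdd_aboveI2[of _ _ "\<bar>K\<bar> + \<bar>L\<bar>"]) auto
  then show ?thesis
    unfolding bidual_norm_def
    by (rule cSUP_upper2[where x = 0]) (auto intro: real_vector.subspace_0[OF subspace_dual])
qed

section \<open>The separated sequence and its convex blocks\<close>

text \<open>The indices of the chosen terms need not increase:
  \<open>range y \<subseteq> range x\<close> suffices because \<open>R_const\<close> ranges over all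
  sequences in the ball.\<close>

lemma separated_sequence:
  assumes \<phi>: "\<phi> \<in> clust s x" and d: "0 \<le> d"
    and far: "\<And>x. d < bidual_norm s (\<lambda>f\<in>dual s. \<phi> f - canonical_embedding s x f)"
  obtains y :: "nat \<Rightarrow> 'a" and f :: "nat \<Rightarrow> 'a \<Rightarrow>\<^sub>L 'k"
    where "range y \<subseteq> range x" "\<And>n. norm (f n) \<le> 1"
    "\<And>k n. k < n \<Longrightarrow> re (blinfun_apply (f n) (y k)) = 0"
    "\<And>k n. n \<le> k \<Longrightarrow> d < re (blinfun_apply (f n) (y k))"
proof -
  have bid: "\<phi> \<in> bidual s" using \<phi> unfolding clust_def by blast
  define good where "good = {f \<in> dual s. norm f \<le> 1 \<and> d < re (\<phi> f)}"
  (* The sets Y and G collect the points and functionals chosen so far. *)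
  define P where "P = (\<lambda>n :: nat. \<lambda>(Y, G, y, f). finite Y \<and> finite G \<and> G \<subseteq> good \<and>
    y \<in> Y \<and> f \<in> G \<and> y \<in> range x \<and> (\<forall>g\<in>G. d < re (blinfun_apply g y)))"
  define Q where "Q = (\<lambda>n :: nat. \<lambda>(Y, G, y :: 'a, f :: 'a \<Rightarrow>\<^sub>L 'k).
    \<lambda>(Y', G' :: ('a \<Rightarrow>\<^sub>L 'k) set, y' :: 'a, f' :: 'a \<Rightarrow>\<^sub>L 'k).
    Y \<subseteq> Y' \<and> G \<subseteq> G' \<and> (\<forall>z\<in>Y. re (blinfun_apply f' z) = 0))"
  have step: "\<exists>Y' G' y' f'. P n (Y', G', y', f') \<and> Q m (Y, G, y, f) (Y', G', y', f')"
    if Y: "finite Y" and G: "finite G" "G \<subseteq> good" for m n Y G y f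
  proof -
    \<comment> \<open>The order matters: \<open>f'\<close> annihilates, in real part, all earlier
      points, and only then is a term chosen that is large on all functionals so far,
      \<open>f'\<close> included. This gives the case \<open>k = n\<close> of the second
      inequality.\<close>
    obtain f' where f': "f' \<in> good" "\<forall>z\<in>Y. re (blinfun_apply f' z) = 0"
      using functional_vanishing_on_finite[OF bid d Y far] unfolding good_def by blast
    have "\<exists>m. \<forall>g\<in>insert f' G. d < re (blinfun_apply g (x m))"
      using f' G by (intro clust_approx[OF \<phi>]) (auto simp: good_def)
    then obtain m where "\<forall>g\<in>insert f' G. d < re (blinfun_apply g (x m))" by blast
    with f' Y G show ?thesis
      unfolding P_def Q_def
      by (intro exI[of _ "insert (x m) Y"] exI[of _ "insert f' G"] exI[of _ "x m"] exI[of _ f'])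
         auto
  qed
  have "\<exists>h. \<forall>n. P n (h n) \<and> Q n (h n) (h (Suc n))"
  proof (rule dependent_nat_choice)
    show "\<exists>t. P 0 t" using step[of "{}" "{}"] by blast
  next
    fix t n assume "P n t"
    then show "\<exists>t'. P (Suc n) t' \<and> Q n t t'"
      by (cases t) (use step in \<open>auto simp: P_def split: prod.splits\<close>)
  qed
  then obtain h where h: "\<And>n. P n (h n)" "\<And>n. Q n (h n) (h (Suc n))" by blast
  define Y G y f where "Y n = fst (h n)" and "G n = fst (snd (h n))"
    and "y n = fst (snd (snd (h n)))" and "f n = snd (snd (snd (h n)))" for n
  have P: "G n \<subseteq> good" "y n \<in> Y n" "f n \<in> G n" "y n \<in> range x"
    "\<And>g. g \<in> G n \<Longrightarrow> d < re (blinfun_apply g (y n))" for n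
    using h(1)[of n] by (auto simp: P_def Y_def G_def y_def f_def split: prod.splits)
  have Q: "Y n \<subseteq> Y (Suc n)" "G n \<subseteq> G (Suc n)"
    "\<And>z. z \<in> Y n \<Longrightarrow> re (blinfun_apply (f (Suc n)) z) = 0" for n
    using h(2)[of n] by (auto simp: Q_def Y_def G_def y_def f_def split: prod.splits)
  have Y: "Y m \<subseteq> Y n" and G: "G m \<subseteq> G n" if "m \<le> n" for m n
    by (rule lift_Suc_mono_le[of Y, OF Q(1) that], rule lift_Suc_mono_le[of G, OF Q(2) that])
  show thesis
  proof
    show "range y \<subseteq> range x" using P by auto
    show "norm (f n) \<le> 1" for n using P(1,3)[of n] unfolding good_def by auto
    show "re (blinfun_apply (f n) (y k)) = 0" if kn: "k < n" for k n
    proof -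
      obtain m where "n = Suc m" "k \<le> m" using kn by (cases n) auto
      then show ?thesis using P(2)[of k] Y[of k m] Q(3)[of "y k" m] by blast
    qed
    \<comment> \<open>\<open>f n\<close> stays in all later sets \<open>G k\<close>, on which
      \<open>y k\<close> was chosen to be large.\<close>
    show "d < re (blinfun_apply (f n) (y k))" if "n \<le> k" for k n
      using that P(3)[of n] P(5)[of "f n" k] G[of n k] by auto
  qed
qed

text \<open>For \<open>m < n\<close> the functional indexed by the first element \<open>k n\<close>
  of the later block has real part zero on the earlier block and at least \<open>d\<close> on the
  later one. Both conditions pass to convex hulls.\<close>

lemma R_const_ge_of_separated:
  fixes y :: "nat \<Rightarrow> 'a" and f :: "nat \<Rightarrow> 'a \<Rightarrow>\<^sub>L 'k"
  assumes y: "range y \<subseteq> cball 0 1" and f: "\<And>n. norm (f n) \<le> 1"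
    and lo: "\<And>k n. k < n \<Longrightarrow> re (blinfun_apply (f n) (y k)) = 0"
    and hi: "\<And>k n. n \<le> k \<Longrightarrow> d < re (blinfun_apply (f n) (y k))"
  shows "d \<le> R_const TYPE('a)"
proof (rule R_const_ge[OF y])
  fix z assume z: "z \<in> cbs y"
  then obtain k where k: "strict_mono k" "\<And>n. z n \<in> convex hull (y ` {k n..<k (Suc n)})"
    unfolding cbs_def by blast
  show "d \<le> ca z"
  proof (rule ca_ge)
    show "range z \<subseteq> cball 0 1" using range_cbs_subset[OF z y] by simp
    fix m n :: nat assume "m < n"
    then have mn: "k (Suc m) \<le> k n" using k(1) by (simp add: strict_mono_less_eq)
    let ?F = "\<lambda>v. re (blinfun_apply (f (k n)) v)"
    have F: "linear ?F"
      by (rule linearI) (auto simp: blinfun.bilinear_simps linear_add linear_cmul linear_re)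
    have "convex hull (y ` {k m..<k (Suc m)}) \<subseteq> ?F -` {0}"
      using mn lo by (intro hull_minimal convex_linear_vimage F) auto
    then have 1: "?F (z m) = 0" using k(2)[of m] by auto
    have "convex hull (y ` {k n..<k (Suc n)}) \<subseteq> ?F -` {d..}"
      using less_imp_le[OF hi] by (intro hull_minimal convex_linear_vimage F) auto
    then have 2: "d \<le> ?F (z n)" using k(2)[of n] by auto
    have "d \<le> ?F (z n - z m)" using 1 2 by (simp add: linear_diff[OF F])
    also have "\<dots> \<le> norm (blinfun_apply (f (k n)) (z n - z m))" by (rule re_le_norm)
    also have "\<dots> \<le> norm (f (k n)) * norm (z n - z m)" by (rule norm_blinfun)
    also have "\<dots> \<le> 1 * norm (z n - z m)" using f by (intro mult_right_mono) auto
    finally show "d \<le> norm (z n - z m)" by simp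
  qed
qed

section \<open>The inequality over a general scalar field\<close>

theorem wck_le_R_const: "wck s (cball 0 1) \<le> R_const TYPE('a)"
  unfolding wck_def
proof (rule cSUP_least)
  show "{x :: nat \<Rightarrow> 'a. range x \<subseteq> cball 0 1} \<noteq> {}"
    by (auto intro: exI[of _ "\<lambda>_. 0"])
next
  fix x :: "nat \<Rightarrow> 'a" assume "x \<in> {x. range x \<subseteq> cball 0 1}"
  then have x: "range x \<subseteq> cball 0 1" by simp
  obtain \<phi> where \<phi>: "\<phi> \<in> clust s x" using clust_nonempty[OF x] by blast
  define D where "D = bidual_setdist s (clust s x) (range (canonical_embedding s))"
  have bdd: "bdd_below ((\<lambda>(\<phi>, \<psi>). bidual_norm s (\<lambda>f\<in>dual s. \<phi> f - \<psi> f)) `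
      (clust s x \<times> range (canonical_embedding s)))"
    using canonical_embedding_bidual
    by (intro bdd_belowI2[of _ 0]) (auto simp: clust_def intro!: bidual_norm_diff_nonneg)
  have D: "D \<le> bidual_norm s (\<lambda>f\<in>dual s. \<phi> f - canonical_embedding s v f)" for v
    unfolding D_def bidual_setdist_def
    using cINF_lower[OF bdd, of "(\<phi>, canonical_embedding s v)"] \<phi> by auto
  show "bidual_setdist s (clust s x) (range (canonical_embedding s)) \<le> R_const TYPE('a)"
    unfolding D_def[symmetric]
  \<comment> \<open>Any \<open>d < D\<close> is strictly below the distance from
    \<open>\<phi>\<close> to every point of \<open>X\<close>, as the construction of the sequence
    requires.\<close>
  proof (rule dense_le)
    fix d assume "d < D"
    show "d \<le> R_const TYPE('a)"
    proof (cases "0 \<le> d")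
      case True
      obtain y :: "nat \<Rightarrow> 'a" and f :: "nat \<Rightarrow> 'a \<Rightarrow>\<^sub>L 'k" where y: "range y \<subseteq> range x"
        and sep: "\<And>n. norm (f n) \<le> 1"
          "\<And>k n. k < n \<Longrightarrow> re (blinfun_apply (f n) (y k)) = 0"
          "\<And>k n. n \<le> k \<Longrightarrow> d < re (blinfun_apply (f n) (y k))"
        using separated_sequence[OF \<phi> True less_le_trans[OF \<open>d < D\<close> D]] by metis
      show ?thesis by (rule R_const_ge_of_separated[OF order_trans[OF y x] sep])
    next
      \<comment> \<open>The separated sequence requires \<open>0 \<le> d\<close>; negative
        \<open>d\<close> are covered by \<open>R_const\<close> being non-negative.\<close>
      case False
      have "range z \<subseteq> cball 0 1" if "z \<in> cbs x" for z
        using range_cbs_subset[OF that x] by simp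
      then have "0 \<le> R_const TYPE('a)" by (intro R_const_ge[OF x] ca_bounds(1))
      with False show ?thesis by simp
    qed
  qed
qed

end

section \<open>The real and the complex case\<close>

theorem theorem4p8:
  fixes scaleC :: "complex \<Rightarrow> 'b::banach \<Rightarrow> 'b"
  shows "(infinite_dimensional (scaleR :: real \<Rightarrow> 'a::banach \<Rightarrow> 'a) \<longrightarrow>
            wck (scaleR :: real \<Rightarrow> 'a \<Rightarrow> 'a) (cball 0 1) \<le> R_const TYPE('a)) \<and>
         (banach_space_over scaleC \<and> infinite_dimensional scaleC \<longrightarrow>
            wck scaleC (cball 0 1) \<le> R_const TYPE('b))"
proof (intro conjI impI)
  interpret banach_space_over "scaleR :: real \<Rightarrow> 'a \<Rightarrow> 'a"
    by (rule banach_space_over_scaleR)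
  \<comment> \<open>Over the reals the rotation is a sign.\<close>
  have "\<exists>u :: real. norm u = 1 \<and> u * z = norm z" for z
    by (rule exI[of _ "if 0 \<le> z then 1 else - 1"]) auto
  then interpret banach_space_re "scaleR :: real \<Rightarrow> 'a \<Rightarrow> 'a" "\<lambda>z. z"
    by unfold_locales (auto simp: linear_id[unfolded id_def])
  show "wck (scaleR :: real \<Rightarrow> 'a \<Rightarrow> 'a) (cball 0 1) \<le> R_const TYPE('a)"
    by (rule wck_le_R_const)
next
  assume "banach_space_over scaleC \<and> infinite_dimensional scaleC"
  then interpret banach_space_over scaleC by blast
  have "\<exists>u. norm u = 1 \<and> Re (u * z) = norm z" for z
  proof (cases "z = 0")
    case False
    then show ?thesis
      \<comment> \<open>Multiplication by the conjugate phase rotates \<open>z\<close> to its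
        modulus.\<close>
      by (intro exI[of _ "cnj z / of_real (norm z)"])
        (auto simp: norm_divide complex_norm_square[symmetric] mult.commute power2_eq_square)
  qed (auto intro: exI[of _ 1])
  then interpret banach_space_re scaleC Re
    by unfold_locales (auto simp: complex_Re_le_cmod bounded_linear.linear[OF bounded_linear_Re])
  show "wck scaleC (cball 0 1) \<le> R_const TYPE('b)" by (rule wck_le_R_const)
qed

end
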